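(* Let $M$ be a finite connected $k$-regular graph with vertex set of size $|M|$, whose automorphism group $\mathcal I$ acts transitively on vertices. Let $\mathcal D=\{y_1,\dots,y_d\}$ ($d=|\mathcal D|$) be a design of strength $t>0$ in $M$, and let $\Omega$ be a nonempty set of vertices with $\lambda=\lambda(\Omega)<t$. Assume one of the following holds: (1) there is a normal subgroup $\mathcal I_0$ of $\mathcal I$ with $\mathcal I/\mathcal I_0$ abelian and $\Omega$ is $\mathcal I_0$-invariant; in this case let $o$ be any vertex; (2) $M$ is distance transitive, $o$ is a vertex, $\mathcal I_0$ is the stabilizer of $o$ in $\mathcal I$, and $\Omega$ is $\mathcal I_0$-invariant; (3) $M$ is distance regular, $o$ is a vertex, $\mathcal I_0$ is the stabilizer of $o$, and $\Omega$ is a union of metric spheres (in the graph distance) centered at $o$; (4) the vertex set of $M$ carries a symmetric association scheme with relations $R_0,\dots,R_m$ such that $M$ is the graph of the relation $R_1$ (so $x\sim y$ iff $(x,y)\in R_1$), $\mathcal I$ is the group of symmetries of the scheme (bijections preserving every relation $R_j$), assumed transitive, $o$ is a vertex, $\mathcal I_0$ is the stabilizer of $o$, and $\Omega$ is a union of sets of the form $\{x:(x,o)\in R_j\}$. For each $i$ let $\tau_i\in\mathcal I$ satisfy $\tau_i(y_i)=o$ and set $\Omega_i=\tau_i^{-1}(\Omega)$. Then $$\Big|\bigcup_{i=1}^d\Omega_i\Big|\ \ge\ \frac{t-\lambda}{t}\,|M|,\qquad\text{and consequently}\qquad |\mathcal D|\ \ge\ \frac{t-\lambda}{t}\cdot\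frac{|M|}{|\Omega|}.$$
   Context: For $f:M\to\mathbb R$, the Laplacian is $\Delta f(x)=kf(x)-\sum_{y\sim x}f(y)$; $\langle f,g\rangle=\sum_x f(x)g(x)$ and $D[f,f]=\langle f,\Delta f\rangle=\frac12\sum_{x\sim y}(f(x)-f(y))^2$ (sum over ordered adjacent pairs). A Laplacian eigenfunction with eigenvalue $\theta$ is a nonzero $\phi$ with $\Delta\phi=\theta\phi$. A set $\mathcal D$ of vertices is a design of strength $t$ if $\sum_{x\in\mathcal D}\phi(x)=0$ for every Laplacian eigenfunction $\phi$ with eigenvalue $0<\theta<t$. For a vertex set $\Omega$, $\lambda(\Omega)=\min\{D[f,f]/\langle f,f\rangle: f:M\to\mathbb R,\ f\ne0,\ f=0\text{ outside }\Omega\}$ (no vanishing is required on $\Omega$'s own boundary vertices). A graph is distance transitive if its automorphism group acts transitively on ordered pairs of vertices at each fixed distance; distance regular has its standard meaning. A symmetric association scheme on a finite set is a partition of $M\times M$ into symmetric relations $R_0=\{(x,x)\}, R_1,\dots,R_m$ whose adjacency matrices span an algebra closed under multiplication. *)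

theory Defs
  imports "HOL-Analysis.Analysis" "HOL-Algebra.Group_Action"
begin

text \<open>
  The vertex set is a finite type \<open>'a\<close>, so that functions on the vertices are exactly the
  functions \<open>'a \<Rightarrow> real\<close>. A graph is given by its set \<open>E\<close> of ordered adjacent pairs
  (symmetric and irreflexive), with \<open>E `` {x}\<close> the set of neighbours of \<open>x\<close>.
\<close>

definition laplacian :: "nat \<Rightarrow> 'a rel \<Rightarrow> ('a \<Rightarrow> real) \<Rightarrow> 'a \<Rightarrow> real" where
  "laplacian k E f x = real k * f x - (\<Sum>y\<in>E `` {x}. f y)"

definition inner_fun :: "('a::finite \<Rightarrow> real) \<Rightarrow> ('a \<Rightarrow> real) \<Rightarrow> real" where
  "inner_fun f g = (\<Sum>x\<in>UNIV. f x * g x)"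

definition dirichlet_form :: "nat \<Rightarrow> 'a::finite rel \<Rightarrow> ('a \<Rightarrow> real) \<Rightarrow> real" where
  "dirichlet_form k E f = inner_fun f (laplacian k E f)"

lemma dirichlet_form_eq_sum_edges:
  fixes E :: "'a::finite rel"
  assumes "sym E" and "\<And>x. card (E `` {x}) = k"
  shows "dirichlet_form k E f = (1/2) * (\<Sum>(x, y)\<in>E. (f x - f y)\<^sup>2)"
proof -
  have E: "E = Sigma UNIV (\<lambda>x. E `` {x})" by auto
  have sig: "(\<Sum>(x, y)\<in>E. g x y) = (\<Sum>x\<in>UNIV. \<Sum>y\<in>E `` {x}. g x y)" for g :: "'a \<Rightarrow> 'a \<Rightarrow> real"
    by (subst E, subst sum.Sigma [symmetric]) auto
  have swap: "(\<Sum>(x, y)\<in>E. (f y)\<^sup>2) = (\<Sum>(x, y)\<in>E. (f x)\<^sup>2)"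
    by (rule sum.reindex_bij_witness [where i = prod.swap and j = prod.swap])
       (use assms(1) in \<open>auto dest: symD\<close>)
  have sq: "(\<Sum>(x, y)\<in>E. (f x)\<^sup>2) = (\<Sum>x\<in>UNIV. real k * (f x)\<^sup>2)"
    by (subst sig) (simp add: assms(2))
  have "(\<Sum>(x, y)\<in>E. (f x - f y)\<^sup>2)
      = (\<Sum>(x, y)\<in>E. (f x)\<^sup>2) + (\<Sum>(x, y)\<in>E. (f y)\<^sup>2) - 2 * (\<Sum>(x, y)\<in>E. f x * f y)"
    by (simp add: sum.distrib [symmetric] sum_subtractf [symmetric] sum_distrib_left
        power2_eq_square algebra_simps case_prod_unfold)
  also have "\<dots> = 2 * ((\<Sum>x\<in>UNIV. real k * (f x)\<^sup>2) - (\<Sum>x\<in>UNIV. \<Sum>y\<in>E `` {x}. f x * f y))"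
    by (simp add: swap sq sig)
  also have "\<dots> = 2 * dirichlet_form k E f"
    by (simp add: dirichlet_form_def inner_fun_def laplacian_def sum_subtractf [symmetric]
        sum_distrib_left power2_eq_square algebra_simps)
  finally show ?thesis by simp
qed

definition laplacian_eigenfunction :: "nat \<Rightarrow> 'a rel \<Rightarrow> real \<Rightarrow> ('a \<Rightarrow> real) \<Rightarrow> bool" where
  "laplacian_eigenfunction k E \<theta> \<phi> \<longleftrightarrow>
     \<phi> \<noteq> (\<lambda>_. 0) \<and> laplacian k E \<phi> = (\<lambda>x. \<theta> * \<phi> x)"

definition design :: "nat \<Rightarrow> 'a rel \<Rightarrow> real \<Rightarrow> 'a set \<Rightarrow> bool" where
  "design k E t D \<longleftrightarrow>
     (\<forall>\<theta> \<phi>. 0 < \<theta> \<and> \<theta> < t \<and> laplacian_eigenfunction k E \<theta> \<phi> \<longrightarrow> (\<Sum>x\<in>D. \<phi> x) = 0)"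

definition dirichlet_eigenvalue :: "nat \<Rightarrow> 'a::finite rel \<Rightarrow> 'a set \<Rightarrow> real" where
  "dirichlet_eigenvalue k E \<Omega> =
     (LEAST r. r \<in> {dirichlet_form k E f / inner_fun f f | f.
                      f \<noteq> (\<lambda>_. 0) \<and> (\<forall>x. x \<notin> \<Omega> \<longrightarrow> f x = 0)})"

definition symmetry_group :: "'a rel set \<Rightarrow> ('a \<Rightarrow> 'a) monoid" where
  "symmetry_group \<R> =
     (BijGroup UNIV)\<lparr>carrier := {g \<in> Bij UNIV. \<forall>r\<in>\<R>. \<forall>x y. (g x, g y) \<in> r \<longleftrightarrow> (x, y) \<in> r}\<rparr>"

definition graph_aut :: "'a rel \<Rightarrow> ('a \<Rightarrow> 'a) monoid" where
  "graph_aut E = symmetry_group {E}"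

text \<open>
  By the following lemma, \<open>transitive_action (symmetry_group \<R>) UNIV id\<close> says no more than
  that the group is transitive on the vertices.
\<close>

lemma group_action_symmetry_group: "group_action (symmetry_group \<R>) UNIV id"
proof -
  let ?H = "{g \<in> Bij UNIV. \<forall>r\<in>\<R>. \<forall>x y. (g x, g y) \<in> r \<longleftrightarrow> (x, y) \<in> r}"
  interpret B: group "BijGroup UNIV" by (rule group_BijGroup)
  have Bij: "g \<in> Bij UNIV \<longleftrightarrow> bij g" for g :: "'a \<Rightarrow> 'a" by (simp add: Bij_def)
  have sub: "subgroup ?H (BijGroup UNIV)"
  proof (rule B.subgroupI)
    show "?H \<subseteq> carrier (BijGroup UNIV)" by (auto simp: BijGroup_def)
    have "id \<in> ?H" by (simp add: Bij)
    then show "?H \<noteq> {}" by blast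
  next
    fix a assume a: "a \<in> ?H"
    then have bij: "bij a" by (simp add: Bij)
    have eq: "inv\<^bsub>BijGroup UNIV\<^esub> a = Hilbert_Choice.inv a"
      using a by (subst inv_BijGroup) auto
    have pres: "(a u, a v) \<in> r \<longleftrightarrow> (u, v) \<in> r" if "r \<in> \<R>" for r u v using a that by auto
    have "(Hilbert_Choice.inv a x, Hilbert_Choice.inv a y) \<in> r \<longleftrightarrow> (x, y) \<in> r" if "r \<in> \<R>" for r x y
      using pres [OF that, of "Hilbert_Choice.inv a x" "Hilbert_Choice.inv a y"] bij
      by (simp add: bij_is_surj surj_f_inv_f)
    then show "inv\<^bsub>BijGroup UNIV\<^esub> a \<in> ?H"
      unfolding eq by (simp add: Bij bij bij_imp_bij_inv)
  next
    fix a b assume "a \<in> ?H" "b \<in> ?H"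
    then show "a \<otimes>\<^bsub>BijGroup UNIV\<^esub> b \<in> ?H"
      by (auto simp: BijGroup_def compose_Bij) (auto simp: compose_def)
  qed
  have "group_hom ((BijGroup UNIV)\<lparr>carrier := ?H\<rparr>) (BijGroup UNIV) id"
    unfolding group_hom_def group_hom_axioms_def hom_def
    using B.subgroup_imp_group [OF sub] subgroup.subset [OF sub] B.is_group by auto
  then show ?thesis by (simp add: group_action_def symmetry_group_def)
qed

definition set_invariant :: "('a \<Rightarrow> 'a) set \<Rightarrow> 'a set \<Rightarrow> bool" where
  "set_invariant H \<Omega> \<longleftrightarrow> (\<forall>g\<in>H. g ` \<Omega> = \<Omega>)"

definition connected_graph :: "'a rel \<Rightarrow> bool" where
  "connected_graph E \<longleftrightarrow> (\<forall>x y. (x, y) \<in> E\<^sup>*)"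

text \<open>The value is meaningful only if \<open>y\<close> is reachable from \<open>x\<close>.\<close>

definition graph_dist :: "'a rel \<Rightarrow> 'a \<Rightarrow> 'a \<Rightarrow> nat" where
  "graph_dist E x y = (LEAST n. (x, y) \<in> E ^^ n)"

definition distance_transitive :: "'a rel \<Rightarrow> bool" where
  "distance_transitive E \<longleftrightarrow> connected_graph E \<and>
     (\<forall>x y x' y'. graph_dist E x y = graph_dist E x' y' \<longrightarrow>
        (\<exists>g\<in>carrier (graph_aut E). g x = x' \<and> g y = y'))"

text \<open>
  The intersection array: \<open>c i\<close> and \<open>b i\<close> count, for \<open>x\<close> and \<open>y\<close> at distance \<open>i\<close>, the
  neighbours of \<open>y\<close> at distance \<open>i - 1\<close> and \<open>i + 1\<close> from \<open>x\<close>.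
\<close>

definition distance_regular :: "'a rel \<Rightarrow> bool" where
  "distance_regular E \<longleftrightarrow> connected_graph E \<and> (\<exists>n. \<forall>x. card (E `` {x}) = n) \<and>
     (\<exists>b c :: nat \<Rightarrow> nat. \<forall>x y.
        card {z \<in> E `` {y}. graph_dist E x z + 1 = graph_dist E x y} = c (graph_dist E x y) \<and>
        card {z \<in> E `` {y}. graph_dist E x z = graph_dist E x y + 1} = b (graph_dist E x y))"

definition adjacency_matrix :: "'a::finite rel \<Rightarrow> real ^ 'a ^ 'a" where
  "adjacency_matrix r = (\<chi> x y. if (x, y) \<in> r then 1 else 0)"

definition symmetric_association_scheme :: "nat \<Rightarrow> (nat \<Rightarrow> 'a::finite rel) \<Rightarrow> bool" where
  "symmetric_association_scheme m R \<longleftrightarrow>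
     partition_on UNIV (R ` {..m}) \<and> inj_on R {..m} \<and> R 0 = Id \<and> (\<forall>j\<le>m. sym (R j)) \<and>
     (let \<A> = span ((\<lambda>j. adjacency_matrix (R j)) ` {..m})
      in \<forall>A\<in>\<A>. \<forall>B\<in>\<A>. A ** B \<in> \<A>)"

end

theory Submission
  imports Defs
begin

text \<open>
  A Dirichlet minimizer \<open>f \<ge> 0\<close> on \<open>\<Omega>\<close> satisfies \<open>\<Delta> f \<le> \<lambda> f\<close> everywhere, and averaging makes it
  compatible with the symmetries. The sum \<open>F\<close> of its translates \<open>f \<circ> \<tau>\<^sub>i\<close> satisfies the same
  inequality. Pairing \<open>F\<close> with an eigenfunction \<open>\<phi>\<close> amounts to summing over the design the image of
  \<open>\<phi>\<close> under an operator that commutes with \<open>\<Delta>\<close>, hence \<open>F\<close> is orthogonal to all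
  eigenfunctions with eigenvalue in \<open>(0, t)\<close>. Writing \<open>S\<close> for the sum of the values of \<open>F\<close>, this
  gives \<open>t (\<langle>F, F\<rangle> - S\<^sup>2 / |M|) \<le> \<langle>F, \<Delta> F\<rangle> \<le> \<lambda> \<langle>F, F\<rangle>\<close>, and Cauchy--Schwarz bounds \<open>S\<^sup>2\<close> by
  \<open>\<langle>F, F\<rangle>\<close> times the size of the support of \<open>F\<close>.
\<close>

section \<open>Inner product, Laplacian and graph automorphisms\<close>

lemma linear_term_zero_if_quadratic_nonneg:
  fixes b c :: real
  assumes "\<And>s. 0 \<le> 2 * s * b + s\<^sup>2 * c"
  shows "b = 0"
proof (rule ccontr)
  assume b: "b \<noteq> 0"
  \<comment> \<open>The point \<open>s = - b / m\<close> minimizes the parabola in which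
    \<open>c\<close> is replaced by the larger, strictly positive \<open>m\<close>; the minimum is
    negative unless \<open>b = 0\<close>.\<close>
  define m where "m = \<bar>c\<bar> + 1"
  have m: "m > 0" "c \<le> m" by (auto simp: m_def)
  have "0 \<le> 2 * (- b / m) * b + (- b / m)\<^sup>2 * c" by (rule assms)
  also have "\<dots> \<le> 2 * (- b / m) * b + (- b / m)\<^sup>2 * m"
    using m by (intro add_left_mono mult_left_mono) auto
  also have "\<dots> = - (b\<^sup>2 / m)" using m by (simp add: power2_eq_square field_simps)
  also have "\<dots> < 0" using m b by simp
  finally show False by simp
qed

lemma inner_fun_commute: "inner_fun f g = inner_fun g f"
  by (simp add: inner_fun_def mult.commute)

lemma inner_fun_self_nonneg: "0 \<le> inner_fun f f"
  by (simp add: inner_fun_def sum_nonneg)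

lemma inner_fun_self_eq_0_iff: "inner_fun f f = 0 \<longleftrightarrow> f = (\<lambda>_. 0)"
  by (auto simp: inner_fun_def sum_nonneg_eq_0_iff)

lemma inner_fun_self_pos: "f \<noteq> (\<lambda>_. 0) \<Longrightarrow> 0 < inner_fun f f"
  using inner_fun_self_nonneg [of f] inner_fun_self_eq_0_iff [of f] by linarith

lemma inner_fun_add_left: "inner_fun (\<lambda>x. f x + g x) h = inner_fun f h + inner_fun g h"
  by (simp add: inner_fun_def distrib_right sum.distrib)

lemma inner_fun_add_right: "inner_fun h (\<lambda>x. f x + g x) = inner_fun h f + inner_fun h g"
  by (simp add: inner_fun_def distrib_left sum.distrib)

lemma inner_fun_scale_left: "inner_fun (\<lambda>x. s * f x) h = s * inner_fun f h"
  by (simp add: inner_fun_def sum_distrib_left mult.assoc)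

lemma inner_fun_scale_right: "inner_fun h (\<lambda>x. s * f x) = s * inner_fun h f"
  by (simp add: inner_fun_def sum_distrib_left mult.left_commute)

lemmas inner_fun_linear = inner_fun_add_left inner_fun_add_right inner_fun_scale_left inner_fun_scale_right

lemma laplacian_add:
  "laplacian k E (\<lambda>x. f x + g x) = (\<lambda>x. laplacian k E f x + laplacian k E g x)"
  by (simp add: laplacian_def fun_eq_iff sum.distrib algebra_simps)

lemma laplacian_scale: "laplacian k E (\<lambda>x. s * f x) = (\<lambda>x. s * laplacian k E f x)"
  by (simp add: laplacian_def fun_eq_iff sum_distrib_left [symmetric] right_diff_distrib)

lemma laplacian_sum:
  "laplacian k E (\<lambda>x. \<Sum>i\<in>I. f i x) = (\<lambda>x. \<Sum>i\<in>I. laplacian k E (f i) x)"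
proof
  fix x
  have "(\<Sum>y\<in>E `` {x}. \<Sum>i\<in>I. f i y) = (\<Sum>i\<in>I. \<Sum>y\<in>E `` {x}. f i y)"
    by (rule sum.swap)
  then show "laplacian k E (\<lambda>x. \<Sum>i\<in>I. f i x) x = (\<Sum>i\<in>I. laplacian k E (f i) x)"
    by (simp add: laplacian_def sum_subtractf sum_distrib_left)
qed

lemma mem_carrier_symmetry_group:
  "g \<in> carrier (symmetry_group \<R>) \<longleftrightarrow>
     bij g \<and> (\<forall>r\<in>\<R>. \<forall>x y. (g x, g y) \<in> r \<longleftrightarrow> (x, y) \<in> r)"
  by (auto simp: symmetry_group_def Bij_def)

lemma mem_carrier_graph_aut:
  "g \<in> carrier (graph_aut E) \<longleftrightarrow> bij g \<and> (\<forall>x y. (g x, g y) \<in> E \<longleftrightarrow> (x, y) \<in> E)"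
  by (simp add: graph_aut_def mem_carrier_symmetry_group)

lemma neighbours_graph_aut:
  assumes "g \<in> carrier (graph_aut E)"
  shows "E `` {g x} = g ` (E `` {x})"
proof -
  have "surj g" and "(g x, g y) \<in> E \<longleftrightarrow> (x, y) \<in> E" for x y
    using assms by (auto simp: mem_carrier_graph_aut bij_is_surj)
  note g = this
  show ?thesis
  proof (intro equalityI subsetI)
    fix y assume y: "y \<in> E `` {g x}"
    obtain z where "y = g z" using g(1) by (metis surjD)
    with y g(2) show "y \<in> g ` (E `` {x})" by auto
  qed (use g(2) in auto)
qed

lemma laplacian_graph_aut:
  assumes "g \<in> carrier (graph_aut E)"
  shows "laplacian k E (\<lambda>x. f (g x)) = (\<lambda>x. laplacian k E f (g x))"
proof
  fix x
  have "inj g" using assms by (simp add: mem_carrier_graph_aut bij_is_inj)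
  then have "(\<Sum>y\<in>E `` {g x}. f y) = (\<Sum>y\<in>E `` {x}. f (g y))"
    unfolding neighbours_graph_aut [OF assms]
    by (subst sum.reindex) (auto intro: inj_on_subset)
  then show "laplacian k E (\<lambda>x. f (g x)) x = laplacian k E f (g x)"
    by (simp add: laplacian_def)
qed

text \<open>Drops the requirement that the eigenfunction be nonzero: below, \<open>\<phi>\<close> is
  the image of an eigenfunction under an averaging operator and may vanish.\<close>

lemma design_sum_eq_0:
  assumes "design k E t D" "0 < \<theta>" "\<theta> < t" "laplacian k E \<phi> = (\<lambda>x. \<theta> * \<phi> x)"
  shows "(\<Sum>x\<in>D. \<phi> x) = 0"
proof (cases "\<phi> = (\<lambda>_. 0)")
  case False
  then show ?thesis
    using assms unfolding design_def laplacian_eigenfunction_def by blast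
qed simp

section \<open>Dirichlet form and Rayleigh minimizers on a regular graph\<close>

locale regular_graph =
  fixes E :: "'a::finite rel" and k :: nat
  assumes sym: "sym E"
    and regular: "card (E `` {x}) = k"
begin

abbreviation lap :: "('a \<Rightarrow> real) \<Rightarrow> 'a \<Rightarrow> real" where
  "lap \<equiv> laplacian k E"

abbreviation dir :: "('a \<Rightarrow> real) \<Rightarrow> real" where
  "dir \<equiv> dirichlet_form k E"

lemma adj_commute: "(x, y) \<in> E \<longleftrightarrow> (y, x) \<in> E"
  using sym by (auto dest: symD)

lemma dir_eq: "dir f = (1/2) * (\<Sum>(x, y)\<in>E. (f x - f y)\<^sup>2)"
  by (rule dirichlet_form_eq_sum_edges [OF sym regular])

lemma laplacian_const: "lap (\<lambda>_. c) = (\<lambda>_. 0)"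
  by (simp add: fun_eq_iff laplacian_def regular)

lemma laplacian_selfadjoint: "inner_fun f (lap g) = inner_fun (lap f) g"
proof -
  have sum_nb: "(\<Sum>y\<in>E `` {x}. h y) = (\<Sum>y\<in>UNIV. if (x, y) \<in> E then h y else 0)"
    for x and h :: "'a \<Rightarrow> real"
    by (rule sum.mono_neutral_cong_left) auto
  have "(\<Sum>x\<in>UNIV. f x * (\<Sum>y\<in>E `` {x}. g y))
      = (\<Sum>x\<in>UNIV. \<Sum>y\<in>UNIV. if (x, y) \<in> E then f x * g y else 0)"
    unfolding sum_nb by (simp add: sum_distrib_left if_distrib cong: if_cong)
  also have "\<dots> = (\<Sum>y\<in>UNIV. \<Sum>x\<in>UNIV. if (y, x) \<in> E then f x * g y else 0)"
    by (subst sum.swap) (simp add: adj_commute)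
  also have "\<dots> = (\<Sum>y\<in>UNIV. (\<Sum>x\<in>E `` {y}. f x) * g y)"
    unfolding sum_nb by (simp add: sum_distrib_right if_distrib if_distribR cong: if_cong)
  finally show ?thesis
    by (simp add: inner_fun_def laplacian_def right_diff_distrib left_diff_distrib
        sum_subtractf mult.left_commute mult.assoc)
qed

lemma dir_nonneg: "0 \<le> dir f"
  unfolding dir_eq by (auto intro!: sum_nonneg)

text \<open>The reverse triangle inequality on each edge. It allows a Dirichlet minimizer to be
  replaced by its absolute value.\<close>

lemma dir_abs_le: "dir (\<lambda>x. \<bar>f x\<bar>) \<le> dir f"
proof -
  have "(\<bar>f x\<bar> - \<bar>f y\<bar>)\<^sup>2 \<le> (f x - f y)\<^sup>2" for x y
    by (rule abs_le_square_iff [THEN iffD1]) linarith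
  then show ?thesis unfolding dir_eq by (auto intro!: sum_mono)
qed

lemma constant_if_dir_eq_0:
  assumes "connected_graph E" and "dir f = 0"
  shows "f x = f y"
proof -
  have "(\<Sum>(x, y)\<in>E. (f x - f y)\<^sup>2) = 0" using assms(2) by (simp add: dir_eq)
  then have edge: "f x = f y" if "(x, y) \<in> E" for x y
    using that by (subst (asm) sum_nonneg_eq_0_iff) auto
  have "(x, y) \<in> E\<^sup>*" using assms(1) by (simp add: connected_graph_def)
  then show ?thesis by (induction rule: rtrancl_induct) (auto dest: edge)
qed

text \<open>First-order condition: along the line \<open>f + s h\<close> the Rayleigh inequality is
  a nonnegative quadratic in \<open>s\<close> with zero constant term, so its linear coefficient
  vanishes. Only one direction \<open>h\<close> is tested, hence the lemma serves for minimization
  over any subspace.\<close>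

lemma rayleigh_critical:
  assumes min: "\<And>s. lam * inner_fun (\<lambda>x. f x + s * h x) (\<lambda>x. f x + s * h x)
                     \<le> dir (\<lambda>x. f x + s * h x)"
    and eq: "dir f = lam * inner_fun f f"
  shows "inner_fun h (lap f) = lam * inner_fun h f"
proof -
  have "inner_fun h (lap f) - lam * inner_fun h f = 0"
  proof (rule linear_term_zero_if_quadratic_nonneg)
    fix s
    have "inner_fun f (lap h) = inner_fun h (lap f)"
      by (metis laplacian_selfadjoint inner_fun_commute)
    then show "0 \<le> 2 * s * (inner_fun h (lap f) - lam * inner_fun h f)
                   + s\<^sup>2 * (dir h - lam * inner_fun h h)"
      using min [of s] eq
      by (simp add: dirichlet_form_def laplacian_add laplacian_scale inner_fun_linear
          inner_fun_commute [of f h] power2_eq_square algebra_simps)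
  qed
  then show ?thesis by simp
qed

text \<open>The Dirichlet form is continuous and attains its minimum on the compact unit sphere of
  \<open>W\<close>; homogeneity carries the bound to all of \<open>W\<close>. Functions are written
  as vectors in \<open>real ^ 'a\<close> to have the topology and the notion of a subspace at
  hand.\<close>

lemma rayleigh_minimizer_exists:
  fixes W :: "(real ^ 'a) set"
  assumes W: "subspace W" and w: "w \<in> W" "w \<noteq> 0"
  obtains v where "v \<in> W" "inner_fun (($) v) (($) v) = 1"
    "\<And>u. u \<in> W \<Longrightarrow> dir (($) v) * inner_fun (($) u) (($) u) \<le> dir (($) u)"
proof -
  have ip: "inner_fun (($) u) (($) u) = (norm u)\<^sup>2" for u :: "real ^ 'a"
    by (simp add: inner_fun_def power2_norm_eq_inner inner_vec_def)
  let ?S = "W \<inter> sphere 0 1"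
  have "compact ?S"
    by (intro closed_Int_compact closed_subspace W compact_sphere)
  moreover have "w /\<^sub>R norm w \<in> ?S"
    using W w by (simp add: subspace_scale)
  then have "?S \<noteq> {}" by blast
  moreover have "continuous_on ?S (\<lambda>v. dir (($) v))"
    unfolding dir_eq case_prod_unfold by (intro continuous_intros)
  ultimately obtain v where v: "v \<in> ?S" and min: "\<And>u. u \<in> ?S \<Longrightarrow> dir (($) v) \<le> dir (($) u)"
    by (metis continuous_attains_inf)
  show thesis
  proof (rule that)
    show "v \<in> W" "inner_fun (($) v) (($) v) = 1" using v by (auto simp: ip)
  next
    fix u assume u: "u \<in> W"
    show "dir (($) v) * inner_fun (($) u) (($) u) \<le> dir (($) u)"
    proof (cases "u = 0")
      case True
      then show ?thesis by (simp add: ip dir_nonneg)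
    next
      case False
      have "u /\<^sub>R norm u \<in> ?S" using W u False by (simp add: subspace_scale)
      then have "dir (($) v) \<le> dir (($) (u /\<^sub>R norm u))" by (rule min)
      also have "($) (u /\<^sub>R norm u) = (\<lambda>x. inverse (norm u) * u $ x)" by auto
      also have "dir \<dots> = dir (($) u) / (norm u)\<^sup>2"
        by (simp add: dirichlet_form_def laplacian_scale inner_fun_linear power2_eq_square
            divide_inverse)
      finally show ?thesis using False by (simp add: ip field_simps)
    qed
  qed
qed

section \<open>Spectral gap and covering bound\<close>

text \<open>
  No diagonalisation is needed: a minimizer of the Rayleigh quotient on the invariant subspace of
  all functions orthogonal to the constants and to the eigenfunctions with eigenvalue in
  \<open>(0, t)\<close> is itself an eigenfunction, so its eigenvalue is at least \<open>t\<close>.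
\<close>

lemma spectral_gap:
  assumes conn: "connected_graph E"
    and F0: "(\<Sum>x\<in>UNIV. F x) = 0"
    and F: "\<And>\<theta> \<phi>. 0 < \<theta> \<Longrightarrow> \<theta> < t \<Longrightarrow> lap \<phi> = (\<lambda>x. \<theta> * \<phi> x) \<Longrightarrow> inner_fun F \<phi> = 0"
  shows "t * inner_fun F F \<le> dir F"
proof (cases "F = (\<lambda>_. 0)")
  case True
  then show ?thesis by (simp add: inner_fun_def dir_nonneg)
next
  case False
  define \<Phi> where
    "\<Phi> = insert (\<lambda>_. 1) {\<phi>. \<exists>\<theta>. 0 < \<theta> \<and> \<theta> < t \<and> lap \<phi> = (\<lambda>x. \<theta> * \<phi> x)}"
  define W :: "(real ^ 'a) set" where "W = {v. \<forall>\<phi>\<in>\<Phi>. inner_fun (($) v) \<phi> = 0}"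
  have lap_\<Phi>: "\<exists>\<theta>. lap \<phi> = (\<lambda>x. \<theta> * \<phi> x)" if "\<phi> \<in> \<Phi>" for \<phi>
    using that by (auto simp: \<Phi>_def laplacian_const intro: exI [of _ 0])
  have subW: "subspace W"
    by (auto simp: W_def subspace_def inner_fun_def distrib_right sum.distrib mult.assoc
        sum_distrib_left [symmetric])
  have FW: "vec_lambda F \<in> W"
    using F F0 by (auto simp: W_def \<Phi>_def inner_fun_def vec_lambda_inverse)
  have "vec_lambda F \<noteq> 0" using False by (auto simp: vec_eq_iff)
  then obtain v where v: "v \<in> W" "inner_fun (($) v) (($) v) = 1"
    and min: "\<And>u. u \<in> W \<Longrightarrow> dir (($) v) * inner_fun (($) u) (($) u) \<le> dir (($) u)"
    using rayleigh_minimizer_exists [OF subW FW] by metis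
  define f where "f = ($) v"
  define \<mu> where "\<mu> = dir f"
  have crit: "inner_fun (($) h) (lap f) = \<mu> * inner_fun (($) h) f" if h: "h \<in> W" for h
  proof (rule rayleigh_critical)
    fix s
    have "v + s *\<^sub>R h \<in> W" using subW v(1) h by (simp add: subspace_add subspace_scale)
    from min [OF this]
    have "\<mu> * inner_fun (($) (v + s *\<^sub>R h)) (($) (v + s *\<^sub>R h)) \<le> dir (($) (v + s *\<^sub>R h))"
      by (simp add: \<mu>_def f_def)
    moreover have "($) (v + s *\<^sub>R h) = (\<lambda>x. f x + s * h $ x)" by (auto simp: f_def)
    ultimately show "\<mu> * inner_fun (\<lambda>x. f x + s * h $ x) (\<lambda>x. f x + s * h $ x)
          \<le> dir (\<lambda>x. f x + s * h $ x)" by simp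
  qed (simp add: \<mu>_def f_def v(2))
  \<comment> \<open>The residual of the eigenvalue equation. It lies in \<open>W\<close>, because
    the Laplacian is selfadjoint and multiplies each member of \<open>\<Phi>\<close> by a scalar.
    Testing criticality of \<open>f\<close> with \<open>e\<close> itself then gives
    \<open>inner_fun e e = 0\<close>.\<close>
  define e where "e = (\<lambda>x. lap f x + (- \<mu>) * f x)"
  have "inner_fun e \<phi> = 0" if \<phi>: "\<phi> \<in> \<Phi>" for \<phi>
  proof -
    have "inner_fun f \<phi> = 0" using v(1) \<phi> by (simp add: W_def f_def)
    moreover obtain \<theta> where "lap \<phi> = (\<lambda>x. \<theta> * \<phi> x)" using lap_\<Phi> [OF \<phi>] by blast
    ultimately show ?thesis
      by (simp only: e_def inner_fun_linear laplacian_selfadjoint [symmetric] mult_zero_right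
          add_0)
  qed
  then have "vec_lambda e \<in> W" by (simp add: W_def vec_lambda_inverse)
  from crit [OF this] have "inner_fun e (lap f) + (- \<mu>) * inner_fun e f = 0"
    by (simp add: vec_lambda_inverse)
  then have "inner_fun e e = 0"
    by (simp only: inner_fun_scale_right [symmetric] inner_fun_add_right [symmetric] e_def [symmetric])
  then have "e = (\<lambda>_. 0)" by (simp add: inner_fun_self_eq_0_iff)
  then have eig: "lap f = (\<lambda>x. \<mu> * f x)" by (simp add: e_def fun_eq_iff)
  \<comment> \<open>With \<open>\<mu> = 0\<close> the function \<open>f\<close> would be constant,
    yet orthogonal to the constant 1 in \<open>\<Phi>\<close>, hence zero.\<close>
  have "\<mu> \<noteq> 0"
  proof
    assume "\<mu> = 0"
    then have const: "f x = f y" for x y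
      by (intro constant_if_dir_eq_0 conn) (simp add: \<mu>_def)
    have "inner_fun f (\<lambda>_. 1) = 0" using v(1) by (simp add: W_def \<Phi>_def f_def)
    also have "inner_fun f (\<lambda>_. 1) = real CARD('a) * f z" for z
    proof -
      have "(\<Sum>x\<in>UNIV. f x) = (\<Sum>x\<in>(UNIV::'a set). f z)" by (intro sum.cong refl const)
      then show ?thesis by (simp add: inner_fun_def)
    qed
    finally have "f = (\<lambda>_. 0)" by auto
    then show False using v(2) by (simp add: f_def [symmetric] inner_fun_def)
  qed
  then have "0 < \<mu>" using dir_nonneg [of f] by (simp add: \<mu>_def)
  \<comment> \<open>Otherwise \<open>f\<close> would belong to \<open>\<Phi>\<close> and be
    orthogonal to itself.\<close>
  have "t \<le> \<mu>"
  proof (rule ccontr)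
    assume "\<not> t \<le> \<mu>"
    then have "f \<in> \<Phi>" using eig \<open>0 < \<mu>\<close> by (auto simp: \<Phi>_def)
    then have "inner_fun f f = 0" using v(1) by (simp add: W_def f_def)
    then show False using v(2) by (simp add: f_def)
  qed
  then have "t * inner_fun F F \<le> \<mu> * inner_fun F F"
    by (intro mult_right_mono inner_fun_self_nonneg)
  also have "\<dots> \<le> dir F" using min [OF FW] by (simp add: \<mu>_def f_def vec_lambda_inverse)
  finally show ?thesis .
qed

text \<open>After centring, \<open>F\<close> is admissible for \<open>spectral_gap\<close>, and
  centring leaves the Dirichlet form unchanged. The squared mean that it removes is what
  Cauchy--Schwarz converts into the size of the support.\<close>

lemma support_bound:
  assumes conn: "connected_graph E"
    and "0 < t" and "lam < t"
    and nonneg: "\<And>x. 0 \<le> F x" and nz: "F \<noteq> (\<lambda>_. 0)"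
    and sub: "\<And>x. lap F x \<le> lam * F x"
    and orth: "\<And>\<theta> \<phi>. 0 < \<theta> \<Longrightarrow> \<theta> < t \<Longrightarrow> lap \<phi> = (\<lambda>x. \<theta> * \<phi> x) \<Longrightarrow> inner_fun F \<phi> = 0"
  shows "(t - lam) / t * real CARD('a) \<le> real (card {x. F x \<noteq> 0})"
proof -
  define N where "N = real CARD('a)"
  define S where "S = (\<Sum>x\<in>UNIV. F x)"
  \<comment> \<open>Minus the mean of \<open>F\<close>, so that \<open>F + c\<close> has sum
    zero.\<close>
  define c where "c = - (S / N)"
  have N: "N > 0" by (simp add: N_def)
  have FF: "inner_fun F F > 0"
    using nz by (rule inner_fun_self_pos)
  have one: "inner_fun (\<lambda>_. b) F = b * S" "inner_fun F (\<lambda>_. b) = b * S" for b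
    by (simp_all add: inner_fun_def S_def sum_distrib_left mult.commute)
  have "t * inner_fun (\<lambda>x. F x + c) (\<lambda>x. F x + c) \<le> dir (\<lambda>x. F x + c)"
  proof (rule spectral_gap [OF conn])
    show "(\<Sum>x\<in>UNIV. F x + c) = 0"
      using N unfolding sum.distrib by (simp add: S_def [symmetric] N_def [symmetric] c_def)
  next
    fix \<theta> \<phi> assume \<theta>: "0 < \<theta>" "\<theta> < t" and \<phi>: "lap \<phi> = (\<lambda>x. \<theta> * \<phi> x)"
    \<comment> \<open>The Laplacian is selfadjoint and kills constants, so constants are orthogonal
      to eigenfunctions with \<open>\<theta> > 0\<close>.\<close>
    have "\<theta> * inner_fun (\<lambda>_. c) \<phi> = inner_fun (\<lambda>_. c) (lap \<phi>)"
      by (simp add: \<phi> inner_fun_linear)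
    also have "\<dots> = 0"
      unfolding laplacian_selfadjoint by (simp add: laplacian_const inner_fun_def)
    finally show "inner_fun (\<lambda>x. F x + c) \<phi> = 0"
      using \<theta> orth [OF \<theta> \<phi>] by (simp add: inner_fun_linear)
  qed
  also have "dir (\<lambda>x. F x + c) = inner_fun (\<lambda>x. F x + c) (lap F)"
    by (simp add: dirichlet_form_def laplacian_add laplacian_const)
  also have "\<dots> = inner_fun F (lap F)"
    by (simp add: inner_fun_linear laplacian_selfadjoint [of "\<lambda>_. c"] laplacian_const)
       (simp add: inner_fun_def)
  \<comment> \<open>Multiplying the pointwise inequality by \<open>F x\<close> keeps its direction
    because \<open>F x\<close> is nonnegative.\<close>
  also have "\<dots> \<le> lam * inner_fun F F"
    unfolding inner_fun_def sum_distrib_left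
    by (rule sum_mono) (use mult_left_mono [OF sub nonneg] in \<open>simp add: mult.left_commute\<close>)
  finally have "t * inner_fun (\<lambda>x. F x + c) (\<lambda>x. F x + c) \<le> lam * inner_fun F F" .
  moreover have "inner_fun (\<lambda>x. F x + c) (\<lambda>x. F x + c) = inner_fun F F - S\<^sup>2 / N"
    using N by (simp add: inner_fun_linear one, simp add: inner_fun_def N_def [symmetric] c_def
        power2_eq_square)
  ultimately have "(t - lam) * inner_fun F F \<le> t * (S\<^sup>2 / N)"
    by (simp only: left_diff_distrib right_diff_distrib)
  moreover have "S\<^sup>2 \<le> inner_fun F F * real (card {x. F x \<noteq> 0})"
  proof -
    \<comment> \<open>Cauchy--Schwarz is applied to \<open>F\<close> and the indicator of its
      support.\<close>
    have "S = (\<Sum>x\<in>UNIV. F x * (if F x \<noteq> 0 then 1 else 0))"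
      unfolding S_def by (rule sum.cong) auto
    then have "S\<^sup>2 \<le> (\<Sum>x\<in>UNIV. (F x)\<^sup>2) * (\<Sum>x\<in>UNIV. (if F x \<noteq> 0 then 1 else 0)\<^sup>2)"
      by (simp only: Cauchy_Schwarz_ineq_sum)
    also have "(\<Sum>x\<in>UNIV. (if F x \<noteq> 0 then 1 else 0 :: real)\<^sup>2) = real (card {x. F x \<noteq> 0})"
      by (simp add: if_distrib [of "\<lambda>z. z\<^sup>2"] sum.If_cases cong: if_cong)
    finally show ?thesis by (simp add: inner_fun_def power2_eq_square)
  qed
  then have "t * (S\<^sup>2 / N) \<le> t * (inner_fun F F * real (card {x. F x \<noteq> 0}) / N)"
    using \<open>0 < t\<close> N by (intro mult_left_mono divide_right_mono) auto
  ultimately have "(t - lam) * inner_fun F F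
      \<le> (t * real (card {x. F x \<noteq> 0}) / N) * inner_fun F F"
    by (simp add: algebra_simps)
  then have "t - lam \<le> t * real (card {x. F x \<noteq> 0}) / N"
    using FF by (rule mult_right_le_imp_le)
  then show ?thesis
    using \<open>0 < t\<close> N unfolding N_def [symmetric] by (simp add: field_simps)
qed

text \<open>The absolute value of a Rayleigh minimizer on \<open>\<Omega>\<close> is again a
  minimizer. Varying it by a point mass inside \<open>\<Omega>\<close> gives equality at that point.
  Outside \<open>\<Omega>\<close> the function vanishes while its neighbours enter the Laplacian
  with a minus sign, so the Laplacian is at most 0 there.\<close>

lemma dirichlet_subsolution_exists:
  assumes "\<Omega> \<noteq> {}"
  obtains f where "\<And>x. 0 \<le> f x" "f \<noteq> (\<lambda>_. 0)" "\<And>x. x \<notin> \<Omega> \<Longrightarrow> f x = 0"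
    "\<And>x. lap f x \<le> dirichlet_eigenvalue k E \<Omega> * f x"
proof -
  define lam where "lam = dirichlet_eigenvalue k E \<Omega>"
  define W :: "(real ^ 'a) set" where "W = {v. \<forall>x. x \<notin> \<Omega> \<longrightarrow> v $ x = 0}"
  have subW: "subspace W" by (auto simp: W_def subspace_def)
  obtain z where "z \<in> \<Omega>" using assms by blast
  then have "axis z 1 \<in> W" by (auto simp: W_def axis_def)
  moreover have "axis z (1::real) \<noteq> 0" by (simp add: axis_eq_0_iff)
  ultimately obtain v where v: "v \<in> W" "inner_fun (($) v) (($) v) = 1"
    and min: "\<And>u. u \<in> W \<Longrightarrow> dir (($) v) * inner_fun (($) u) (($) u) \<le> dir (($) u)"
    using rayleigh_minimizer_exists [OF subW] by metis
  have min': "dir (($) v) * inner_fun g g \<le> dir g" if "\<And>x. x \<notin> \<Omega> \<Longrightarrow> g x = 0" for g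
    using min [of "vec_lambda g"] that by (simp add: W_def vec_lambda_inverse)
  \<comment> \<open>\<open>LEAST\<close> over the reals is informative only when the minimum is
    attained; \<open>v\<close> attains it.\<close>
  have lam_eq: "lam = dir (($) v)"
    unfolding lam_def dirichlet_eigenvalue_def
  proof (rule Least_equality)
    have "($) v \<noteq> (\<lambda>_. 0)" using v(2) by (auto simp: inner_fun_def)
    then show "dir (($) v) \<in> {dir f / inner_fun f f |f. f \<noteq> (\<lambda>_. 0) \<and> (\<forall>x. x \<notin> \<Omega> \<longrightarrow> f x = 0)}"
      using v by (auto simp: W_def intro!: exI [of _ "($) v"])
  next
    fix r assume "r \<in> {dir f / inner_fun f f |f. f \<noteq> (\<lambda>_. 0) \<and> (\<forall>x. x \<notin> \<Omega> \<longrightarrow> f x = 0)}"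
    then obtain f where f: "r = dir f / inner_fun f f" "f \<noteq> (\<lambda>_. 0)" "\<And>x. x \<notin> \<Omega> \<Longrightarrow> f x = 0"
      by auto
    have "inner_fun f f > 0"
      using f(2) by (rule inner_fun_self_pos)
    then show "dir (($) v) \<le> r" using min' [of f] f by (simp add: pos_le_divide_eq)
  qed
  from min' have min: "lam * inner_fun g g \<le> dir g" if "\<And>x. x \<notin> \<Omega> \<Longrightarrow> g x = 0" for g
    using that by (simp add: lam_eq)
  define f where "f = (\<lambda>x. \<bar>v $ x\<bar>)"
  have ff: "inner_fun f f = 1" using v(2) by (simp add: f_def inner_fun_def)
  have f0: "f x = 0" if "x \<notin> \<Omega>" for x using v(1) that by (simp add: f_def W_def)
  have "dir f \<le> lam" unfolding f_def lam_eq by (rule dir_abs_le)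
  moreover have "lam * inner_fun f f \<le> dir f" using f0 by (rule min)
  ultimately have eq: "dir f = lam * inner_fun f f" using ff by simp
  show thesis
  proof (rule that)
    show "0 \<le> f x" for x by (simp add: f_def)
    show "f \<noteq> (\<lambda>_. 0)" using ff by (auto simp: inner_fun_def)
    show "f x = 0" if "x \<notin> \<Omega>" for x using that by (rule f0)
    show "lap f x \<le> dirichlet_eigenvalue k E \<Omega> * f x" for x
    proof (cases "x \<in> \<Omega>")
      case True
      define h where "h = (\<lambda>y. if y = x then 1 else 0 :: real)"
      have h: "inner_fun h g = g x" for g
        unfolding inner_fun_def h_def
        by (simp add: if_distrib [of "\<lambda>z. z * _"] cong: if_cong)
      have "inner_fun h (lap f) = lam * inner_fun h f"
        by (rule rayleigh_critical [OF min eq]) (use True f0 in \<open>auto simp: h_def\<close>)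
      then show ?thesis by (simp add: h lam_def)
    next
      case False
      then show ?thesis by (simp add: laplacian_def f0) (simp add: f_def sum_nonneg)
    qed
  qed
qed

text \<open>Reduces every case to the orthogonality condition \<open>orth\<close>. Automorphisms
  commute with the Laplacian, so the sum of the translates is again a subsolution; nonnegativity
  excludes cancellation, so it is nonzero.\<close>

lemma covering_bound:
  assumes conn: "connected_graph E" and "0 < t" and "lam < t"
    and nonneg: "\<And>x. 0 \<le> f x" and nz: "f \<noteq> (\<lambda>_. 0)"
    and supp: "\<And>x. x \<notin> \<Omega> \<Longrightarrow> f x = 0"
    and sub: "\<And>x. lap f x \<le> lam * f x"
    and I: "finite I" "I \<noteq> {}"
    and \<tau>: "\<And>i. i \<in> I \<Longrightarrow> \<tau> i \<in> carrier (graph_aut E)"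
    and orth: "\<And>\<theta> \<phi>. 0 < \<theta> \<Longrightarrow> \<theta> < t \<Longrightarrow> lap \<phi> = (\<lambda>x. \<theta> * \<phi> x) \<Longrightarrow>
                 (\<Sum>i\<in>I. \<Sum>x\<in>UNIV. f (\<tau> i x) * \<phi> x) = 0"
  shows "(t - lam) / t * real CARD('a) \<le> real (card (\<Union>i\<in>I. \<tau> i -` \<Omega>))"
proof -
  define F where "F = (\<lambda>x. \<Sum>i\<in>I. f (\<tau> i x))"
  have "(t - lam) / t * real CARD('a) \<le> real (card {x. F x \<noteq> 0})"
  proof (rule support_bound [OF conn \<open>0 < t\<close> \<open>lam < t\<close>])
    show "0 \<le> F x" for x by (simp add: F_def sum_nonneg nonneg)
    show "F \<noteq> (\<lambda>_. 0)"
    proof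
      assume F0: "F = (\<lambda>_. 0)"
      obtain i where i: "i \<in> I" using I by blast
      obtain z where z: "f z \<noteq> 0" using nz by auto
      obtain x where x: "\<tau> i x = z"
        using \<tau> [OF i] by (metis mem_carrier_graph_aut bij_pointE)
      have "F x = 0" using F0 by simp
      then have "f (\<tau> i x) = 0"
        using I i by (simp add: F_def sum_nonneg_eq_0_iff nonneg)
      with x z show False by simp
    qed
    show "lap F x \<le> lam * F x" for x
      unfolding F_def laplacian_sum sum_distrib_left
      by (intro sum_mono) (simp add: laplacian_graph_aut \<tau> sub)
    fix \<theta> \<phi> assume "0 < \<theta>" "\<theta> < t" "lap \<phi> = (\<lambda>x. \<theta> * \<phi> x)"
    then have "(\<Sum>i\<in>I. \<Sum>x\<in>UNIV. f (\<tau> i x) * \<phi> x) = 0" by (rule orth)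
    then show "inner_fun F \<phi> = 0"
      unfolding F_def inner_fun_def sum_distrib_right by (subst sum.swap)
  qed
  also have "\<dots> \<le> real (card (\<Union>i\<in>I. \<tau> i -` \<Omega>))"
  proof (intro of_nat_mono card_mono)
    have "\<exists>i\<in>I. f (\<tau> i x) \<noteq> 0" if "F x \<noteq> 0" for x
      using that unfolding F_def by (meson sum.neutral)
    then show "{x. F x \<noteq> 0} \<subseteq> (\<Union>i\<in>I. \<tau> i -` \<Omega>)" using supp by blast
  qed simp
  finally show ?thesis .
qed

end

section \<open>Averaging over the classes of a colouring\<close>

text \<open>
  In cases (2)--(4) the function on \<open>\<Omega>\<close> is averaged over the classes \<open>c x0 x = j\<close> of a symmetric
  colouring \<open>c\<close> of the pairs of vertices: the graph distance or the index of the relation.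
\<close>

locale colour_regular_graph = regular_graph +
  fixes c :: "'a \<Rightarrow> 'a \<Rightarrow> nat"
  assumes colour_commute: "c x y = c y x"
    and colour_count: "c x y = c x' y' \<Longrightarrow>
      card {z \<in> E `` {y}. c x z = j} = card {z \<in> E `` {y'}. c x' z = j}"
begin

text \<open>Grouping neighbours by colour exposes the counts controlled by
  \<open>colour_count\<close>; \<open>range (case_prod c)\<close> is the finite set of all colours
  that occur.\<close>

lemma sum_neighbours_colour:
  fixes u :: "nat \<Rightarrow> real"
  shows "(\<Sum>z\<in>E `` {y}. u (c x z)) = (\<Sum>j\<in>range (case_prod c). real (card {z \<in> E `` {y}. c x z = j}) * u j)"
proof -
  have "(\<Sum>z\<in>E `` {y}. u (c x z))
      = (\<Sum>j\<in>range (case_prod c). \<Sum>z\<in>{z \<in> E `` {y}. c x z = j}. u (c x z))"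
    by (rule sum.group [symmetric]) auto
  also have "\<dots> = (\<Sum>j\<in>range (case_prod c). \<Sum>z\<in>{z \<in> E `` {y}. c x z = j}. u j)"
    by (intro sum.cong) auto
  finally show ?thesis by simp
qed

text \<open>Thus the Laplacian acts on the profile \<open>u\<close> alone, in the same way for every
  base point.\<close>

lemma laplacian_colour_cong:
  assumes "c x y = c x' y'"
  shows "lap (\<lambda>z. u (c x z)) y = lap (\<lambda>z. u (c x' z)) y'"
proof -
  have "(\<Sum>z\<in>E `` {y}. u (c x z)) = (\<Sum>z\<in>E `` {y'}. u (c x' z))"
    unfolding sum_neighbours_colour using colour_count [OF assms] by simp
  then show ?thesis by (simp add: laplacian_def assms)
qed

text \<open>The operator with kernel \<open>u (c y x)\<close> commutes with the Laplacian: applied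
  to the kernel in \<open>y\<close> or in \<open>x\<close>, the Laplacian yields the same function
  of the colour, and selfadjointness then moves it onto \<open>\<phi>\<close>.\<close>

lemma laplacian_colour_kernel:
  assumes "lap \<phi> = (\<lambda>x. \<theta> * \<phi> x)"
  shows "lap (\<lambda>y. inner_fun (\<lambda>x. u (c y x)) \<phi>) = (\<lambda>y. \<theta> * inner_fun (\<lambda>x. u (c y x)) \<phi>)"
proof
  fix y
  have "lap (\<lambda>y. inner_fun (\<lambda>x. u (c y x)) \<phi>) y
      = (\<Sum>x\<in>UNIV. lap (\<lambda>y. \<phi> x * u (c x y)) y)"
    unfolding inner_fun_def laplacian_sum by (simp add: mult.commute colour_commute)
  also have "\<dots> = (\<Sum>x\<in>UNIV. \<phi> x * lap (\<lambda>z. u (c x z)) y)"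
    by (simp add: laplacian_scale)
  also have "\<dots> = (\<Sum>x\<in>UNIV. \<phi> x * lap (\<lambda>z. u (c y z)) x)"
    by (intro sum.cong refl arg_cong2 [where f = "(*)"] laplacian_colour_cong colour_commute)
  also have "\<dots> = inner_fun \<phi> (lap (\<lambda>z. u (c y z)))"
    by (simp add: inner_fun_def)
  also have "\<dots> = \<theta> * inner_fun (\<lambda>x. u (c y x)) \<phi>"
    unfolding laplacian_selfadjoint assms inner_fun_linear by (simp add: inner_fun_commute)
  finally show "lap (\<lambda>y. inner_fun (\<lambda>x. u (c y x)) \<phi>) y = \<theta> * inner_fun (\<lambda>x. u (c y x)) \<phi>" .
qed

text \<open>Conditional expectation given the colour seen from \<open>p\<close>, kept as a function
  of the colour so that it can be used with other base points. A colour that does not occur gets 0 /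
  0 = 0.\<close>

definition colour_mean :: "'a \<Rightarrow> ('a \<Rightarrow> real) \<Rightarrow> nat \<Rightarrow> real" where
  "colour_mean p f j = (\<Sum>x | c p x = j. f x) / real (card {x. c p x = j})"

text \<open>Averaging is the orthogonal projection onto functions constant on the colour classes
  about \<open>p\<close>, so such an \<open>r\<close> cannot distinguish \<open>f\<close> from its
  mean. After the swap of sums, both \<open>r\<close> and the class size \<open>n\<close> can be
  taken at \<open>z\<close> instead of \<open>x\<close>.\<close>

lemma inner_fun_colour_mean:
  assumes "\<And>x x'. c p x = c p x' \<Longrightarrow> r x = r x'"
  shows "inner_fun r (\<lambda>x. colour_mean p f (c p x)) = inner_fun r f"
proof -
  define n where "n x = real (card {z. c p z = c p x})" for x
  have n: "n x \<noteq> 0" for x by (auto simp: n_def)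
  have "inner_fun r (\<lambda>x. colour_mean p f (c p x))
      = (\<Sum>x\<in>UNIV. \<Sum>z | c p z = c p x. r x * f z / n x)"
    by (simp add: inner_fun_def colour_mean_def n_def sum_distrib_left sum_divide_distrib)
  also have "\<dots> = (\<Sum>x\<in>UNIV. \<Sum>z\<in>UNIV. if c p z = c p x then r x * f z / n x else 0)"
    by (intro sum.cong refl sum.mono_neutral_cong_left) auto
  also have "\<dots> = (\<Sum>z\<in>UNIV. \<Sum>x\<in>UNIV. if c p z = c p x then r x * f z / n x else 0)"
    by (rule sum.swap)
  also have "\<dots> = (\<Sum>z\<in>UNIV. \<Sum>x | c p x = c p z. r z * f z / n z)"
    by (intro sum.cong refl sum.mono_neutral_cong_right) (auto simp: n_def dest: assms)
  also have "\<dots> = (\<Sum>z\<in>UNIV. n z * (r z * f z / n z))"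
    by (simp add: n_def)
  also have "\<dots> = inner_fun r f"
    using n by (simp add: inner_fun_def)
  finally show ?thesis .
qed

text \<open>The inequality is tested against the indicator \<open>h\<close> of one colour class. As
  \<open>lap h\<close> is constant on classes, the mean may be exchanged for \<open>f\<close>; as
  the Laplacian of the mean is also constant on classes, the summed inequality is the pointwise one
  times \<open>n\<close>.\<close>

lemma colour_mean_subsolution:
  assumes sub: "\<And>x. lap f x \<le> lam * f x"
  shows "lap (\<lambda>x. colour_mean p f (c p x)) z \<le> lam * colour_mean p f (c p z)"
proof -
  let ?g = "\<lambda>x. colour_mean p f (c p x)"
  define w :: "nat \<Rightarrow> real" where "w j = (if j = c p z then 1 else 0)" for j
  define h where "h = (\<lambda>x. w (c p x))"
  define n where "n = real (card {x. c p x = c p z})"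
  have n: "n > 0" unfolding n_def of_nat_0_less_iff by (subst card_gt_0_iff) auto
  have h: "inner_fun h e = (\<Sum>x | c p x = c p z. e x)" for e
    unfolding inner_fun_def h_def w_def by (rule sum.mono_neutral_cong_right) auto
  have "n * lap ?g z = inner_fun h (lap ?g)"
  proof -
    have "(\<Sum>x | c p x = c p z. lap ?g x) = (\<Sum>x | c p x = c p z. lap ?g z)"
      by (rule sum.cong) (auto intro: laplacian_colour_cong)
    then show ?thesis by (simp add: h n_def)
  qed
  also have "\<dots> = inner_fun (lap h) ?g" by (rule laplacian_selfadjoint)
  also have "\<dots> = inner_fun (lap h) f"
    unfolding h_def by (rule inner_fun_colour_mean) (rule laplacian_colour_cong)
  also have "\<dots> = inner_fun h (lap f)" by (rule laplacian_selfadjoint [symmetric])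
  also have "\<dots> \<le> lam * inner_fun h f"
    unfolding h sum_distrib_left by (rule sum_mono) (rule sub)
  also have "\<dots> = lam * (n * ?g z)"
    using n by (simp add: h colour_mean_def n_def)
  finally have "n * lap ?g z \<le> n * (lam * ?g z)" by (simp add: mult.left_commute)
  then show ?thesis using n by simp
qed

text \<open>The translate by \<open>\<tau> i\<close> of the averaged function is the kernel
  \<open>u (c (y i) x)\<close>. Pairing with \<open>\<phi>\<close> and summing over \<open>i\<close>
  therefore sums an eigenfunction, or zero, over the design.\<close>

lemma colour_covering_bound:
  assumes conn: "connected_graph E" and "0 < t"
    and design: "design k E t D" and "D \<noteq> {}" and y: "bij_betw y I D"
    and \<Omega>: "\<Omega> \<noteq> {}" "\<Omega> = {x. c p x \<in> J}"
    and lam: "dirichlet_eigenvalue k E \<Omega> < t"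
    and \<tau>: "\<And>i. i \<in> I \<Longrightarrow> \<tau> i \<in> carrier (graph_aut E)"
      "\<And>i x. i \<in> I \<Longrightarrow> c p (\<tau> i x) = c (y i) x"
  shows "(t - dirichlet_eigenvalue k E \<Omega>) / t * real CARD('a) \<le> real (card (\<Union>i\<in>I. \<tau> i -` \<Omega>))"
proof -
  obtain f where f: "\<And>x. 0 \<le> f x" "f \<noteq> (\<lambda>_. 0)" "\<And>x. x \<notin> \<Omega> \<Longrightarrow> f x = 0"
    "\<And>x. lap f x \<le> dirichlet_eigenvalue k E \<Omega> * f x"
    using dirichlet_subsolution_exists [OF \<Omega>(1)] by metis
  define u where "u = colour_mean p f"
  show ?thesis
  proof (rule covering_bound [OF conn \<open>0 < t\<close> lam, where f = "\<lambda>x. u (c p x)"])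
    show "0 \<le> u (c p x)" for x
      by (simp add: u_def colour_mean_def sum_nonneg f(1))
    \<comment> \<open>Averaging preserves the total, and a nonnegative \<open>f\<close> with total
      zero vanishes.\<close>
    show "(\<lambda>x. u (c p x)) \<noteq> (\<lambda>_. 0)"
    proof
      assume "(\<lambda>x. u (c p x)) = (\<lambda>_. 0)"
      then have "inner_fun (\<lambda>_. 1) f = 0"
        using inner_fun_colour_mean [of p "\<lambda>_. 1" f] by (simp add: u_def inner_fun_def)
      then have "f x = 0" for x
        by (simp add: inner_fun_def sum_nonneg_eq_0_iff f(1))
      with f(2) show False by auto
    qed
    \<comment> \<open>\<open>\<Omega>\<close> is a union of colour classes, so the class of a point
      outside it misses it entirely.\<close>
    show "u (c p x) = 0" if "x \<notin> \<Omega>" for x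
    proof -
      have "(\<Sum>z | c p z = c p x. f z) = 0"
        by (rule sum.neutral) (use that f(3) \<Omega>(2) in auto)
      then show ?thesis by (simp add: u_def colour_mean_def)
    qed
    show "lap (\<lambda>x. u (c p x)) x \<le> dirichlet_eigenvalue k E \<Omega> * u (c p x)" for x
      unfolding u_def by (rule colour_mean_subsolution) (rule f(4))
    show "finite I" "I \<noteq> {}"
      using y \<open>D \<noteq> {}\<close> bij_betw_finite by (fastforce simp: bij_betw_def)+
    show "\<tau> i \<in> carrier (graph_aut E)" if "i \<in> I" for i using that by (rule \<tau>)
    fix \<theta> \<phi> assume \<theta>: "0 < \<theta>" "\<theta> < t" and \<phi>: "lap \<phi> = (\<lambda>x. \<theta> * \<phi> x)"
    have "(\<Sum>i\<in>I. \<Sum>x\<in>UNIV. u (c p (\<tau> i x)) * \<phi> x)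
        = (\<Sum>i\<in>I. inner_fun (\<lambda>x. u (c (y i) x)) \<phi>)"
      by (simp add: \<tau>(2) inner_fun_def)
    also have "\<dots> = (\<Sum>y\<in>D. inner_fun (\<lambda>x. u (c y x)) \<phi>)"
      by (rule sum.reindex_bij_betw [OF y])
    also have "\<dots> = 0"
      by (rule design_sum_eq_0 [OF design \<theta> laplacian_colour_kernel [OF \<phi>]])
    finally show "(\<Sum>i\<in>I. \<Sum>x\<in>UNIV. u (c p (\<tau> i x)) * \<phi> x) = 0" .
  qed
qed

end

section \<open>Averaging over automorphisms with an abelian quotient\<close>

lemma graph_aut_comp_closed:
  assumes "a \<in> carrier (graph_aut E)" "b \<in> carrier (graph_aut E)"
  shows "a \<circ> b \<in> carrier (graph_aut E)"
  using assms by (auto simp: mem_carrier_graph_aut bij_comp)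

lemma mult_graph_aut: "a \<otimes>\<^bsub>graph_aut E\<^esub> b = a \<circ> b"
  if "a \<in> carrier (graph_aut E)" "b \<in> carrier (graph_aut E)"
  using that
  by (auto simp: mem_carrier_graph_aut graph_aut_def symmetry_group_def BijGroup_def Bij_def
      compose_def fun_eq_iff)

lemma one_graph_aut: "\<one>\<^bsub>graph_aut E\<^esub> = id"
  by (simp add: graph_aut_def symmetry_group_def BijGroup_def fun_eq_iff)

text \<open>Composition on the right with a surjection is injective on maps, hence permutes the
  finite set \<open>H\<close> that it sends into itself.\<close>

lemma sum_comp_right_eq:
  fixes h :: "'a::finite \<Rightarrow> 'b::comm_monoid_add" and H :: "('a \<Rightarrow> 'a) set"
  assumes "\<And>a. a \<in> H \<Longrightarrow> a \<circ> g \<in> H" and "surj g"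
  shows "(\<Sum>a\<in>H. h (a (g x))) = (\<Sum>a\<in>H. h (a x))"
proof -
  have inj: "inj_on (\<lambda>a. a \<circ> g) H"
  proof (rule inj_onI)
    fix a b assume "a \<circ> g = b \<circ> g"
    then have "\<And>z. a (g z) = b (g z)" by (simp add: fun_eq_iff)
    then show "a = b" using \<open>surj g\<close> by (metis ext surjD)
  qed
  have "(\<lambda>a. a \<circ> g) ` H = H"
    by (rule endo_inj_surj [OF _ _ inj]) (use assms(1) in auto)
  then have "(\<Sum>a\<in>H. h (a x)) = (\<Sum>a\<in>(\<lambda>a. a \<circ> g) ` H. h (a x))" by simp
  also have "\<dots> = (\<Sum>a\<in>H. h (a (g x)))"
    using inj by (simp add: sum.reindex)
  finally show ?thesis by simp
qed

text \<open>The double sum of \<open>h (g x)\<close> is evaluated twice: each \<open>g\<close>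
  permutes the vertices, and by transitivity the sum over the group is the same at every base
  point.\<close>

lemma sum_transitive_graph_aut:
  fixes E :: "'a::finite rel" and h :: "'a \<Rightarrow> real"
  assumes "transitive_action (graph_aut E) UNIV id"
  shows "real (card (carrier (graph_aut E))) * (\<Sum>x\<in>UNIV. h x)
       = real CARD('a) * (\<Sum>g\<in>carrier (graph_aut E). h (g p))"
proof -
  let ?G = "carrier (graph_aut E)"
  have "(\<Sum>x\<in>UNIV. h (g x)) = (\<Sum>x\<in>UNIV. h x)" if "g \<in> ?G" for g
    using that by (intro sum.reindex_bij_betw) (simp add: mem_carrier_graph_aut)
  then have "real (card ?G) * (\<Sum>x\<in>UNIV. h x) = (\<Sum>g\<in>?G. \<Sum>x\<in>UNIV. h (g x))" by simp
  also have "\<dots> = (\<Sum>x\<in>UNIV. \<Sum>g\<in>?G. h (g x))" by (rule sum.swap)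
  also have "\<dots> = (\<Sum>x\<in>(UNIV::'a set). \<Sum>g\<in>?G. h (g p))"
  proof (rule sum.cong [OF refl])
    fix x
    obtain a where a: "a \<in> ?G" "a p = x"
      using transitive_action.unique_orbit [OF assms, of p x] by auto
    have "surj a" using a by (simp add: mem_carrier_graph_aut bij_is_surj)
    with a show "(\<Sum>g\<in>?G. h (g x)) = (\<Sum>g\<in>?G. h (g p))"
      using sum_comp_right_eq [of ?G a h p] by (simp add: graph_aut_comp_closed)
  qed
  finally show ?thesis by simp
qed

text \<open>Commuting cosets give \<open>H #> (a \<otimes> b) = H #> (b \<otimes> a)\<close>, and
  the left side contains \<open>a \<otimes> b\<close>.\<close>

lemma comm_quotient_commutator:
  fixes G (structure)
  assumes N: "H \<lhd> G" and "comm_group (G Mod H)"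
    and a: "a \<in> carrier G" and b: "b \<in> carrier G"
  shows "\<exists>h\<in>H. a \<otimes> b = h \<otimes> (b \<otimes> a)"
proof -
  interpret normal H G by (rule N)
  interpret Q: comm_group "G Mod H" by (rule assms(2))
  have "H #> a \<in> carrier (G Mod H)" "H #> b \<in> carrier (G Mod H)"
    using a b by (auto simp: FactGroup_def RCOSETS_def)
  then have "(H #> a) <#> (H #> b) = (H #> b) <#> (H #> a)"
    using Q.m_comm by (simp add: FactGroup_def)
  then have "H #> (a \<otimes> b) = H #> (b \<otimes> a)"
    using a b by (simp add: rcos_sum)
  moreover have "a \<otimes> b \<in> H #> (a \<otimes> b)"
    using a b by (simp add: rcos_self is_subgroup)
  ultimately show ?thesis by (auto simp: r_coset_def)
qed

context regular_graph
begin

text \<open>Here the operator commuting with the Laplacian is built from the group. Summing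
  \<open>f\<close> over \<open>H\<close> makes it insensitive to the order in which two
  automorphisms are applied, and this turns translation by \<open>\<tau> i\<close> into a change of
  base point from \<open>p\<close> to \<open>y i\<close>.\<close>

lemma abelian_quotient_covering_bound:
  assumes conn: "connected_graph E" and "0 < t"
    and trans: "transitive_action (graph_aut E) UNIV id"
    and design: "design k E t D" and "D \<noteq> {}" and y: "bij_betw y I D"
    and \<Omega>: "\<Omega> \<noteq> {}"
    and lam: "dirichlet_eigenvalue k E \<Omega> < t"
    and H: "H \<lhd> graph_aut E" "comm_group (graph_aut E Mod H)" "set_invariant H \<Omega>"
    and \<tau>: "\<And>i. i \<in> I \<Longrightarrow> \<tau> i \<in> carrier (graph_aut E)" "\<And>i. i \<in> I \<Longrightarrow> \<tau> i (y i) = p"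
  shows "(t - dirichlet_eigenvalue k E \<Omega>) / t * real CARD('a) \<le> real (card (\<Union>i\<in>I. \<tau> i -` \<Omega>))"
proof -
  let ?G = "carrier (graph_aut E)"
  have subgr: "subgroup H (graph_aut E)" using H(1) by (rule normal_imp_subgroup)
  have HG: "a \<in> ?G" if "a \<in> H" for a using subgroup.mem_carrier [OF subgr that] .
  have H_id: "id \<in> H" using subgroup.one_closed [OF subgr] by (simp add: one_graph_aut)
  have H_comp: "a \<circ> b \<in> H" if "a \<in> H" "b \<in> H" for a b
    using subgroup.m_closed [OF subgr that] that by (simp add: mult_graph_aut HG)
  have surj: "surj a" and inj: "inj a" if "a \<in> ?G" for a
    using that by (simp_all add: mem_carrier_graph_aut bij_is_surj bij_is_inj)
  obtain f where f: "\<And>x. 0 \<le> f x" "f \<noteq> (\<lambda>_. 0)" "\<And>x. x \<notin> \<Omega> \<Longrightarrow> f x = 0"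
    "\<And>x. lap f x \<le> dirichlet_eigenvalue k E \<Omega> * f x"
    using dirichlet_subsolution_exists [OF \<Omega>(1)] by metis
  define F where "F = (\<lambda>x. \<Sum>a\<in>H. f (a x))"
  have F_inv: "F (a x) = F x" if "a \<in> H" for a x
    unfolding F_def using that by (intro sum_comp_right_eq) (simp_all add: H_comp surj HG)
  \<comment> \<open>The two compositions differ by an element of \<open>H\<close> on the left, which
    \<open>F\<close> absorbs.\<close>
  have F_comm: "F (a (b x)) = F (b (a x))" if a: "a \<in> ?G" and b: "b \<in> ?G" for a b x
  proof -
    obtain h where h: "h \<in> H" "a \<circ> b = h \<circ> (b \<circ> a)"
      using comm_quotient_commutator [OF H(1,2) a b] a b
      by (auto simp: mult_graph_aut graph_aut_comp_closed HG)
    then show ?thesis using F_inv [of h "b (a x)"] by (simp add: fun_eq_iff)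
  qed
  show ?thesis
  proof (rule covering_bound [OF conn \<open>0 < t\<close> lam, where f = F])
    show "0 \<le> F x" for x by (simp add: F_def sum_nonneg f(1))
    show "F \<noteq> (\<lambda>_. 0)"
    proof
      assume "F = (\<lambda>_. 0)"
      then have "(\<Sum>a\<in>H. f (a x)) = 0" for x by (simp add: F_def fun_eq_iff)
      then have "\<forall>a\<in>H. f (a x) = 0" for x
        by (subst (asm) sum_nonneg_eq_0_iff) (auto simp: f(1))
      with H_id have "f x = 0" for x by fastforce
      with f(2) show False by auto
    qed
    show "F x = 0" if "x \<notin> \<Omega>" for x
      unfolding F_def
    proof (rule sum.neutral, rule ballI, rule f(3))
      fix a assume a: "a \<in> H"
      then have "a ` \<Omega> = \<Omega>" using H(3) by (simp add: set_invariant_def)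
      then show "a x \<notin> \<Omega>" using that inj [OF HG [OF a]] by (metis inj_image_mem_iff)
    qed
    show "lap F x \<le> dirichlet_eigenvalue k E \<Omega> * F x" for x
      unfolding F_def laplacian_sum sum_distrib_left
      by (intro sum_mono) (simp add: laplacian_graph_aut HG f(4))
    show "finite I" "I \<noteq> {}"
      using y \<open>D \<noteq> {}\<close> bij_betw_finite by (fastforce simp: bij_betw_def)+
    show "\<tau> i \<in> ?G" if "i \<in> I" for i using that by (rule \<tau>)
    fix \<theta> \<phi> assume \<theta>: "0 < \<theta>" "\<theta> < t" and \<phi>: "lap \<phi> = (\<lambda>x. \<theta> * \<phi> x)"
    \<comment> \<open>A combination of the translates of \<open>\<phi>\<close> by automorphisms, all
      satisfying the same eigenvalue equation.\<close>
    define \<psi> where "\<psi> = (\<lambda>q. \<Sum>g\<in>?G. F (g p) * \<phi> (g q))"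
    have \<psi>: "lap \<psi> = (\<lambda>q. \<theta> * \<psi> q)"
      unfolding \<psi>_def laplacian_sum laplacian_scale
      by (auto simp: laplacian_graph_aut \<phi> sum_distrib_left mult.left_commute intro!: sum.cong)
    have orbit: "real (card ?G) * (\<Sum>x\<in>UNIV. F (\<tau> i x) * \<phi> x) = real CARD('a) * \<psi> (y i)"
      if i: "i \<in> I" for i
    proof -
      \<comment> \<open>\<open>F_comm\<close> moves \<open>\<tau> i\<close> past \<open>g\<close>,
        where it sends \<open>y i\<close> to \<open>p\<close>.\<close>
      have "(\<Sum>g\<in>?G. F (\<tau> i (g (y i))) * \<phi> (g (y i))) = \<psi> (y i)"
        unfolding \<psi>_def by (rule sum.cong) (simp_all add: F_comm \<tau> i)
      then show ?thesis using sum_transitive_graph_aut [OF trans, of _ "y i"] by simp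
    qed
    have "real (card ?G) * (\<Sum>i\<in>I. \<Sum>x\<in>UNIV. F (\<tau> i x) * \<phi> x)
        = real CARD('a) * (\<Sum>i\<in>I. \<psi> (y i))"
      unfolding sum_distrib_left [of _ _ I] by (rule sum.cong) (simp_all add: orbit)
    also have "(\<Sum>i\<in>I. \<psi> (y i)) = (\<Sum>q\<in>D. \<psi> q)"
      by (rule sum.reindex_bij_betw [OF y])
    also have "\<dots> = 0" by (rule design_sum_eq_0 [OF design \<theta> \<psi>])
    finally have "real (card ?G) * (\<Sum>i\<in>I. \<Sum>x\<in>UNIV. F (\<tau> i x) * \<phi> x) = 0" by simp
    moreover have "card ?G \<noteq> 0" using HG [OF H_id] by auto
    ultimately show "(\<Sum>i\<in>I. \<Sum>x\<in>UNIV. F (\<tau> i x) * \<phi> x) = 0" by simp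
  qed
qed

end

section \<open>Graph distance as a colouring\<close>

lemma graph_dist_relpow:
  assumes "connected_graph E"
  shows "(x, y) \<in> E ^^ graph_dist E x y"
  using assms unfolding graph_dist_def connected_graph_def
  by (metis LeastI_ex rtrancl_imp_relpow)

lemma graph_dist_le: "(x, y) \<in> E ^^ n \<Longrightarrow> graph_dist E x y \<le> n"
  unfolding graph_dist_def by (rule Least_le)

lemma graph_dist_neighbour_le:
  assumes "connected_graph E" and "(y, z) \<in> E"
  shows "graph_dist E x z \<le> graph_dist E x y + 1"
proof -
  have "(x, z) \<in> E ^^ Suc (graph_dist E x y)"
    using graph_dist_relpow [OF assms(1)] assms(2) by auto
  then show ?thesis using graph_dist_le by fastforce
qed

lemma relpow_sym:
  assumes "sym E" and "(x, y) \<in> E ^^ n"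
  shows "(y, x) \<in> E ^^ n"
  using assms(2)
proof (induction n arbitrary: y)
  case (Suc n)
  then obtain z where z: "(x, z) \<in> E ^^ n" "(z, y) \<in> E" by auto
  have "(y, z) \<in> E" using z(2) assms(1) by (auto dest: symD)
  then show ?case using Suc.IH [OF z(1)] by (rule relpow_Suc_I2)
qed simp

lemma graph_dist_commute:
  assumes "sym E"
  shows "graph_dist E x y = graph_dist E y x"
proof -
  have "(x, y) \<in> E ^^ n \<longleftrightarrow> (y, x) \<in> E ^^ n" for n
    using relpow_sym [OF assms] by blast
  then show ?thesis by (simp add: graph_dist_def)
qed

lemma graph_dist_graph_aut:
  assumes g: "g \<in> carrier (graph_aut E)"
  shows "graph_dist E (g x) (g y) = graph_dist E x y"
proof -
  have "(g x, g y) \<in> E ^^ n \<longleftrightarrow> (x, y) \<in> E ^^ n" for n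
  proof (induction n arbitrary: y)
    case 0
    show ?case using g by (auto simp: mem_carrier_graph_aut dest: bij_is_inj injD)
  next
    case (Suc n)
    have pres: "(g z, g w) \<in> E \<longleftrightarrow> (z, w) \<in> E" for z w
      using g by (simp add: mem_carrier_graph_aut)
    have "(g x, g y) \<in> E ^^ Suc n \<longleftrightarrow> (\<exists>z. (g x, z) \<in> E ^^ n \<and> (z, g y) \<in> E)" by auto
    also have "\<dots> \<longleftrightarrow> (\<exists>z. (g x, g z) \<in> E ^^ n \<and> (g z, g y) \<in> E)"
      using g by (metis mem_carrier_graph_aut bij_pointE)
    also have "\<dots> \<longleftrightarrow> (x, y) \<in> E ^^ Suc n" by (auto simp: Suc.IH pres)
    finally show ?case .
  qed
  then show ?thesis by (simp add: graph_dist_def)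
qed

text \<open>The intersection array supplies the counts one step nearer and one step farther. Those
  at equal distance are the rest of the \<open>k\<close> neighbours, and the triangle inequality
  leaves no others.\<close>

lemma (in regular_graph) distance_regular_colour:
  assumes "distance_regular E"
  shows "colour_regular_graph E k (graph_dist E)"
proof
  show "graph_dist E x y = graph_dist E y x" for x y
    by (rule graph_dist_commute [OF sym])
  have conn: "connected_graph E" using assms by (simp add: distance_regular_def)
  \<comment> \<open>\<open>a\<close> is the sequence called \<open>c\<close> in
    \<open>distance_regular\<close>.\<close>
  obtain a b where
    a: "\<And>x y. card {z \<in> E `` {y}. graph_dist E x z + 1 = graph_dist E x y} = a (graph_dist E x y)" and
    b: "\<And>x y. card {z \<in> E `` {y}. graph_dist E x z = graph_dist E x y + 1} = b (graph_dist E x y)"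
    using assms unfolding distance_regular_def by metis
  have near: "graph_dist E x z \<le> graph_dist E x y + 1 \<and> graph_dist E x y \<le> graph_dist E x z + 1"
    if "z \<in> E `` {y}" for x y z
    using that graph_dist_neighbour_le [OF conn] adj_commute by auto
  \<comment> \<open>Writing \<open>j + 1 = i\<close> keeps truncated subtraction from counting
    distance 0 as one step nearer when \<open>i = 0\<close>.\<close>
  have count: "card {z \<in> E `` {y}. graph_dist E x z = j} =
      (let i = graph_dist E x y in
        if j + 1 = i then a i else if j = i + 1 then b i else if j = i then k - a i - b i else 0)"
    for x y j
  proof -
    define i where "i = graph_dist E x y"
    let ?S = "\<lambda>j. {z \<in> E `` {y}. graph_dist E x z = j}"
    consider "j + 1 = i" | "j = i + 1" | "j = i" | "j + 1 \<noteq> i" "j \<noteq> i + 1" "j \<noteq> i" by blast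
    then show ?thesis
    proof cases
      case 1
      then have "?S j = {z \<in> E `` {y}. graph_dist E x z + 1 = graph_dist E x y}"
        by (auto simp: i_def)
      then show ?thesis using 1 a [of y x] by (simp add: i_def)
    next
      case 2
      then show ?thesis using b [of y x] by (simp add: i_def)
    next
      case 3
      let ?A = "{z \<in> E `` {y}. graph_dist E x z + 1 = i}" and ?B = "{z \<in> E `` {y}. graph_dist E x z = i + 1}"
      have "E `` {y} = ?A \<union> (?B \<union> ?S i)"
      proof (intro equalityI subsetI)
        fix z assume z: "z \<in> E `` {y}"
        then have "graph_dist E x z + 1 = i \<or> graph_dist E x z = i + 1 \<or> graph_dist E x z = i"
          using near [OF z, of x] unfolding i_def by linarith
        with z show "z \<in> ?A \<union> (?B \<union> ?S i)" by blast
      qed blast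
      moreover have "card (?A \<union> (?B \<union> ?S i)) = card ?A + card (?B \<union> ?S i)"
        by (rule card_Un_disjoint) auto
      moreover have "card (?B \<union> ?S i) = card ?B + card (?S i)"
        by (rule card_Un_disjoint) auto
      ultimately have "k = card ?A + card ?B + card (?S i)"
        using regular [of y] by (simp only: add.assoc)
      then have "card (?S i) = k - a i - b i"
        using a [of y x] b [of y x] by (simp add: i_def)
      then show ?thesis using 3 by (simp add: i_def Let_def)
    next
      case 4
      have "?S j = {}"
      proof (rule equals0I)
        fix z assume "z \<in> ?S j"
        then show False using near [of z y x] 4 unfolding i_def by auto
      qed
      then have "card (?S j) = 0" by simp
      then show ?thesis using 4 unfolding i_def [symmetric] by (simp add: Let_def)
    qed
  qed
  show "card {z \<in> E `` {y}. graph_dist E x z = j} = card {z \<in> E `` {y'}. graph_dist E x' z = j}"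
    if "graph_dist E x y = graph_dist E x' y'" for x y x' y' j
    unfolding count that ..
qed

lemma (in regular_graph) distance_transitive_colour:
  assumes "distance_transitive E"
  shows "colour_regular_graph E k (graph_dist E)"
proof
  show "graph_dist E x y = graph_dist E y x" for x y
    by (rule graph_dist_commute [OF sym])
  fix x y x' y' j assume "graph_dist E x y = graph_dist E x' y'"
  then obtain g where g: "g \<in> carrier (graph_aut E)" "g x = x'" "g y = y'"
    using assms unfolding distance_transitive_def by blast
  have "inj g" using g(1) by (simp add: mem_carrier_graph_aut bij_is_inj)
  have "{z \<in> E `` {y'}. graph_dist E x' z = j} = g ` {z \<in> E `` {y}. graph_dist E x z = j}"
    using neighbours_graph_aut [OF g(1), of y] g(2,3) graph_dist_graph_aut [OF g(1), of x] by auto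
  then show "card {z \<in> E `` {y}. graph_dist E x z = j} = card {z \<in> E `` {y'}. graph_dist E x' z = j}"
    using \<open>inj g\<close> by (simp add: card_image inj_on_subset)
qed

text \<open>Distance transitivity for pairs with common first vertex \<open>p\<close> makes the
  stabilizer of \<open>p\<close> transitive on each sphere about \<open>p\<close>, so an invariant
  set is a union of spheres.\<close>

lemma distance_transitive_invariant_set:
  assumes "distance_transitive E" and inv: "set_invariant (stabilizer (graph_aut E) id p) \<Omega>"
  shows "\<Omega> = {x. graph_dist E p x \<in> graph_dist E p ` \<Omega>}"
proof (intro equalityI subsetI)
  fix x assume "x \<in> {x. graph_dist E p x \<in> graph_dist E p ` \<Omega>}"
  then obtain z where z: "z \<in> \<Omega>" "graph_dist E p z = graph_dist E p x" by auto
  then obtain g where g: "g \<in> carrier (graph_aut E)" "g p = p" "g z = x"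
    using assms(1) unfolding distance_transitive_def by metis
  then have "g ` \<Omega> = \<Omega>" using inv by (simp add: set_invariant_def stabilizer_def)
  then show "x \<in> \<Omega>" using z(1) g(3) by blast
qed auto

section \<open>Relations of an association scheme as colours\<close>

definition scheme_colour :: "nat \<Rightarrow> (nat \<Rightarrow> 'a rel) \<Rightarrow> 'a \<Rightarrow> 'a \<Rightarrow> nat" where
  "scheme_colour m R x y = (THE j. j \<le> m \<and> (x, y) \<in> R j)"

text \<open>The relations partition all pairs and are indexed injectively, so the index described by
  \<open>THE\<close> exists and is unique.\<close>

lemma scheme_colour_eq_iff:
  assumes "symmetric_association_scheme m R"
  shows "scheme_colour m R x y = j \<longleftrightarrow> j \<le> m \<and> (x, y) \<in> R j"
proof -
  have part: "partition_on UNIV (R ` {..m})" and inj: "inj_on R {..m}"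
    using assms by (simp_all add: symmetric_association_scheme_def)
  have "(x, y) \<in> \<Union> (R ` {..m})"
    using partition_onD1 [OF part] by simp
  moreover have "i = j" if "i \<le> m" "j \<le> m" "(x, y) \<in> R i" "(x, y) \<in> R j" for i j
  proof -
    have "R i = R j"
      using partition_onD2 [OF part] that unfolding disjoint_def by blast
    then show ?thesis using inj that by (simp add: inj_on_def)
  qed
  ultimately have ex1: "\<exists>!j. j \<le> m \<and> (x, y) \<in> R j" by auto
  show ?thesis
    unfolding scheme_colour_def using theI' [OF ex1] the1_equality [OF ex1] by blast
qed

text \<open>Agreement of two fixed entries defines a subspace of matrices, and the adjacency
  matrices lie in it.\<close>

lemma scheme_span_entry:
  assumes S: "symmetric_association_scheme m R"
    and A: "A \<in> span ((\<lambda>j. adjacency_matrix (R j)) ` {..m})"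
    and eq: "scheme_colour m R x y = scheme_colour m R x' y'"
  shows "A $ x $ y = A $ x' $ y'"
  using A
proof (induction rule: span_induct)
  case base
  show ?case by (auto simp: subspace_def)
next
  case (step A)
  then obtain j where j: "j \<le> m" "A = adjacency_matrix (R j)" by auto
  then have "(x, y) \<in> R j \<longleftrightarrow> (x', y') \<in> R j"
    using eq scheme_colour_eq_iff [OF S] by metis
  then show ?case by (simp add: j(2) adjacency_matrix_def)
qed

text \<open>The required counts are the entries of the product of the adjacency matrices of
  \<open>R j\<close> and \<open>R 1\<close>. Closure under multiplication puts this product in the
  span, where entries depend only on the colour.\<close>

lemma scheme_colour_regular_graph:
  assumes S: "symmetric_association_scheme m R" and "1 \<le> m"
    and reg: "\<And>x. card (R 1 `` {x}) = k"
  shows "colour_regular_graph (R 1) k (scheme_colour m R)"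
proof
  note iff = scheme_colour_eq_iff [OF S]
  have sym: "sym (R j)" if "j \<le> m" for j
    using S that by (simp add: symmetric_association_scheme_def)
  then have swap: "(x, y) \<in> R j \<longleftrightarrow> (y, x) \<in> R j" if "j \<le> m" for x y j
    using that by (meson symD)
  show "sym (R 1)" using sym \<open>1 \<le> m\<close> by simp
  show "card (R 1 `` {x}) = k" for x by (rule reg)
  show "scheme_colour m R x y = scheme_colour m R y x" for x y
    using iff swap by metis
  fix x y x' y' j assume eq: "scheme_colour m R x y = scheme_colour m R x' y'"
  show "card {z \<in> R 1 `` {y}. scheme_colour m R x z = j}
      = card {z \<in> R 1 `` {y'}. scheme_colour m R x' z = j}"
  proof (cases "j \<le> m")
    case True
    let ?A = "\<lambda>j. adjacency_matrix (R j)"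
    have entry: "(?A j ** ?A 1) $ x $ y = real (card {z \<in> R 1 `` {y}. scheme_colour m R x z = j})" for x y
    proof -
      have "(?A j ** ?A 1) $ x $ y = (\<Sum>z\<in>UNIV. if (x, z) \<in> R j \<and> (z, y) \<in> R 1 then 1 else 0)"
        unfolding matrix_matrix_mult_def adjacency_matrix_def by (auto intro!: sum.cong)
      also have "\<dots> = real (card {z. (x, z) \<in> R j \<and> (z, y) \<in> R 1})"
        by (simp add: sum.If_cases)
      also have "{z. (x, z) \<in> R j \<and> (z, y) \<in> R 1} = {z \<in> R 1 `` {y}. scheme_colour m R x z = j}"
        using True swap [OF \<open>1 \<le> m\<close>] by (auto simp: iff)
      finally show ?thesis .
    qed
    have "?A j ** ?A 1 \<in> span (?A ` {..m})"
      using S True \<open>1 \<le> m\<close> by (simp add: symmetric_association_scheme_def Let_def span_base)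
    from scheme_span_entry [OF S this eq] show ?thesis by (simp only: entry of_nat_eq_iff)
  next
    case False
    then show ?thesis by (simp add: iff)
  qed
qed

section \<open>The four cases and the union bound\<close>

theorem theorem3p1:
  fixes E :: "'a::finite rel"
    and k d :: nat
    and t lam :: real
    and D \<Omega> :: "'a set"
    and x0 :: 'a
    and y :: "nat \<Rightarrow> 'a"
    and G :: "('a \<Rightarrow> 'a) monoid"
    and G0 :: "('a \<Rightarrow> 'a) set"
    and \<tau> :: "nat \<Rightarrow> 'a \<Rightarrow> 'a"
  assumes graph: "sym E" "irrefl E"
    and regular: "\<And>x. card (E `` {x}) = k"
    and connected: "connected_graph E"
    and transitive: "transitive_action (graph_aut E) UNIV id"
    and t_pos: "t > 0"
    and design: "design k E t D"
    and D_enum: "D \<noteq> {}" "d = card D" "bij_betw y {1..d} D"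
    and \<Omega>_nonempty: "\<Omega> \<noteq> {}"
    and lam: "lam = dirichlet_eigenvalue k E \<Omega>" "lam < t"
    and cases:
      "(G = graph_aut E \<and> G0 \<lhd> G \<and> comm_group (G Mod G0) \<and> set_invariant G0 \<Omega>)
       \<or> (G = graph_aut E \<and> distance_transitive E \<and> G0 = stabilizer G id x0 \<and>
          set_invariant G0 \<Omega>)
       \<or> (G = graph_aut E \<and> distance_regular E \<and> G0 = stabilizer G id x0 \<and>
          (\<exists>J. \<Omega> = (\<Union>r\<in>J. {x. graph_dist E x0 x = r})))
       \<or> (\<exists>m R. symmetric_association_scheme m R \<and> 1 \<le> m \<and> E = R 1 \<and>
          G = symmetry_group (R ` {..m}) \<and> transitive_action G UNIV id \<and>
          G0 = stabilizer G id x0 \<and>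
          (\<exists>J\<subseteq>{..m}. \<Omega> = (\<Union>j\<in>J. {x. (x, x0) \<in> R j})))"
    and \<tau>: "\<And>i. i \<in> {1..d} \<Longrightarrow> \<tau> i \<in> carrier G \<and> \<tau> i (y i) = x0"
  shows "real (card (\<Union>i\<in>{1..d}. \<tau> i -` \<Omega>)) \<ge> (t - lam) / t * real CARD('a)
       \<and> real (card D) \<ge> (t - lam) / t * (real CARD('a) / real (card \<Omega>))"
proof -
  interpret regular_graph E k by standard (rule graph regular)+
  \<comment> \<open>In the scheme case a symmetry preserves every relation, in particular
    \<open>R 1 = E\<close>, because \<open>1 \<le> m\<close>.\<close>
  have aut: "\<tau> i \<in> carrier (graph_aut E)" if "i \<in> {1..d}" for i
    using cases
  proof (elim disjE exE conjE)
    fix m R assume "1 \<le> m" "E = R 1" "G = symmetry_group (R ` {..m})"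
    then show ?thesis
      using \<tau> [OF that] by (auto simp: mem_carrier_graph_aut mem_carrier_symmetry_group)
  qed (use \<tau> that in auto)
  have lam_less: "dirichlet_eigenvalue k E \<Omega> < t" using lam by simp
  have bound: "(t - lam) / t * real CARD('a) \<le> real (card (\<Union>i\<in>{1..d}. \<tau> i -` \<Omega>))"
    using cases
  proof (elim disjE exE conjE)
    assume "G = graph_aut E" "G0 \<lhd> G" "comm_group (G Mod G0)" "set_invariant G0 \<Omega>"
    then show ?thesis
      unfolding lam(1) using \<tau>
      by (intro abelian_quotient_covering_bound [OF connected t_pos transitive design D_enum(1,3)
            \<Omega>_nonempty lam_less]) auto
  next
    assume G: "G = graph_aut E" "distance_transitive E" "G0 = stabilizer G id x0"
      "set_invariant G0 \<Omega>"
    interpret colour_regular_graph E k "graph_dist E" using G(2) by (rule distance_transitive_colour)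
    have \<Omega>: "\<Omega> = {x. graph_dist E x0 x \<in> graph_dist E x0 ` \<Omega>}"
      using G by (intro distance_transitive_invariant_set) auto
    have "graph_dist E x0 (\<tau> i x) = graph_dist E (y i) x" if "i \<in> {1..d}" for i x
      using graph_dist_graph_aut [OF aut [OF that], of "y i" x] \<tau> [OF that] by simp
    then show ?thesis
      unfolding lam(1)
      by (intro colour_covering_bound [OF connected t_pos design D_enum(1,3) \<Omega>_nonempty \<Omega> lam_less] aut)
  next
    fix J assume G: "distance_regular E" "\<Omega> = (\<Union>r\<in>J. {x. graph_dist E x0 x = r})"
    interpret colour_regular_graph E k "graph_dist E" using G(1) by (rule distance_regular_colour)
    have \<Omega>: "\<Omega> = {x. graph_dist E x0 x \<in> J}" using G(2) by auto
    have "graph_dist E x0 (\<tau> i x) = graph_dist E (y i) x" if "i \<in> {1..d}" for i x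
      using graph_dist_graph_aut [OF aut [OF that], of "y i" x] \<tau> [OF that] by simp
    then show ?thesis
      unfolding lam(1)
      by (intro colour_covering_bound [OF connected t_pos design D_enum(1,3) \<Omega>_nonempty \<Omega> lam_less] aut)
  next
    fix m R J
    assume S: "symmetric_association_scheme m R" and m: "1 \<le> m" and E: "E = R 1"
      and G: "G = symmetry_group (R ` {..m})"
      and J: "J \<subseteq> {..m}" "\<Omega> = (\<Union>j\<in>J. {x. (x, x0) \<in> R j})"
    note iff = scheme_colour_eq_iff [OF S]
    interpret colour_regular_graph E k "scheme_colour m R"
      unfolding E by (rule scheme_colour_regular_graph [OF S m]) (use regular E in auto)
    \<comment> \<open>The relations are given with \<open>x0\<close> as second entry, whereas colour
      classes have the base point first; \<open>colour_commute\<close> reconciles the two.\<close>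
    have "x \<in> \<Omega> \<longleftrightarrow> scheme_colour m R x x0 \<in> J" for x
    proof
      assume "x \<in> \<Omega>"
      then obtain j where "j \<in> J" "(x, x0) \<in> R j" using J(2) by blast
      moreover from this have "scheme_colour m R x x0 = j" using J(1) iff by blast
      ultimately show "scheme_colour m R x x0 \<in> J" by simp
    qed (use J(2) iff in blast)
    then have \<Omega>: "\<Omega> = {x. scheme_colour m R x0 x \<in> J}"
      by (auto simp: colour_commute)
    have "scheme_colour m R x0 (\<tau> i x) = scheme_colour m R (y i) x" if "i \<in> {1..d}" for i x
    proof -
      have "(\<tau> i (y i), \<tau> i x) \<in> R j \<longleftrightarrow> (y i, x) \<in> R j" if "j \<le> m" for j
        using \<tau> [OF \<open>i \<in> {1..d}\<close>] that unfolding G mem_carrier_symmetry_group by blast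
      then show ?thesis using \<tau> [OF that] iff by metis
    qed
    then show ?thesis
      unfolding lam(1)
      by (intro colour_covering_bound [OF connected t_pos design D_enum(1,3) \<Omega>_nonempty \<Omega> lam_less] aut)
  qed
  \<comment> \<open>Each preimage has the size of \<open>\<Omega>\<close> since
    \<open>\<tau> i\<close> is bijective; the union bound then yields the second inequality.\<close>
  have "card (\<tau> i -` \<Omega>) = card \<Omega>" if "i \<in> {1..d}" for i
    using aut [OF that] by (intro card_vimage_inj) (auto simp: mem_carrier_graph_aut bij_is_inj bij_is_surj)
  then have "card (\<Union>i\<in>{1..d}. \<tau> i -` \<Omega>) \<le> card D * card \<Omega>"
    using card_UN_le [of "{1..d}" "\<lambda>i. \<tau> i -` \<Omega>"] D_enum(2) by simp
  then have "real (card (\<Union>i\<in>{1..d}. \<tau> i -` \<Omega>)) \<le> real (card D) * real (card \<Omega>)"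
    by (metis of_nat_le_iff of_nat_mult)
  with bound have "(t - lam) / t * real CARD('a) \<le> real (card D) * real (card \<Omega>)" by simp
  moreover have "real (card \<Omega>) > 0" using \<Omega>_nonempty by (simp add: card_gt_0_iff)
  ultimately have "(t - lam) / t * (real CARD('a) / real (card \<Omega>)) \<le> real (card D)"
    by (simp only: times_divide_eq_right pos_divide_le_eq)
  with bound show ?thesis by simp
qed

end
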